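(* Let $a\in\mathbb{R}$, $\alpha\in(0,1)$, and let $w:\mathbb{N}_a\to\mathbb{R}\setminus\{0\}$ satisfy $\frac{w(a)}{w(k)}>0$ for all $k\in\mathbb{N}_{a+1}$. Let $\gamma$ be a locally Lipschitz class $\mathcal{K}$ function and let $h:\mathbb{N}_{a+1}\to\mathbb{R}$ be bounded. Let $x,y:\mathbb{N}_a\to\mathbb{R}$ satisfy $x(k)\ge 0$ and $y(k)\ge 0$ for all $k$, $x(a)=y(a)$, and, for all $k\in\mathbb{N}_{a+1}$, $${}_a^{\rm C}\nabla_k^{\alpha,w(k)}x(k)\ge -\gamma(x(k))+h(k),\qquad {}_a^{\rm C}\nabla_k^{\alpha,w(k)}y(k)\le -\gamma(y(k))+h(k).$$ Then $x(k)\ge y(k)$ for all $k\in\mathbb{N}_{a+1}$.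
   Context: For $a\in\mathbb{R}$, $\mathbb{N}_a:=\{a,a+1,a+2,\dots\}$. A class $\mathcal{K}$ function is a continuous strictly increasing function $\gamma:[0,\infty)\to[0,\infty)$ with $\gamma(0)=0$. The nabla difference is $\nabla x(k):=x(k)-x(k-1)$. For $\beta\in(-1,1)$ and $k\in\mathbb{N}_{a+1}$, the Grünwald–Letnikov difference/sum is $${}_a^{\rm G}\nabla_k^{\beta}x(k):=\sum_{i=0}^{k-a-1}(-1)^i\binom{\beta}{i}x(k-i),\qquad \binom{p}{q}:=\frac{\Gamma(p+1)}{\Gamma(q+1)\Gamma(p-q+1)}.$$ For $\alpha\in(0,1)$ and $k\in\mathbb{N}_{a+1}$, the Caputo difference is ${}_a^{\rm C}\nabla_k^{\alpha}x(k):={}_a^{\rm G}\nabla_k^{\alpha-1}\nabla x(k)$. Given a tempered function $w$, the Caputo tempered difference is ${}_a^{\rm C}\nabla_k^{\alpha,w(k)}x(k):=w^{-1}(k)\,{}_a^{\rm C}\nabla_k^{\alpha}[w(k)x(k)]$, where $w^{-1}(k)=1/w(k)$. *)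

theory Defs
  imports "HOL-Analysis.Analysis"
begin

text \<open>
  Functions on \<open>\<nat>\<^sub>a\<close> are rendered as total functions \<open>real \<Rightarrow> real\<close>; only their values on
  \<open>\<nat>\<^sub>a\<close> are constrained or used.
\<close>

definition Nats_from :: "real \<Rightarrow> real set" where
  "Nats_from a = {a + real n | n. True}"

definition class_K :: "(real \<Rightarrow> real) \<Rightarrow> bool" where
  "class_K \<gamma> \<longleftrightarrow> \<gamma> ` {0..} \<subseteq> {0..} \<and> continuous_on {0..} \<gamma> \<and> strict_mono_on {0..} \<gamma> \<and> \<gamma> 0 = 0"

text \<open>
  The library notion \<^const>\<open>local_lipschitz\<close> is for families of functions; a constant family gives
  the single-function notion: every point of \<open>X\<close> has a neighbourhood in \<open>X\<close> on which \<open>f\<close> is Lipschitz.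
\<close>

abbreviation locally_lipschitz_on :: "real set \<Rightarrow> (real \<Rightarrow> real) \<Rightarrow> bool" where
  "locally_lipschitz_on X f \<equiv> local_lipschitz (UNIV :: real set) X (\<lambda>_. f)"

text \<open>
  At its poles \<^const>\<open>Gamma\<close> is \<open>0\<close>, so when only \<open>p - q + 1\<close> is a pole the value is \<open>0\<close>,
  in agreement with the usual convention \<open>1 / \<Gamma> = 0\<close> there.
\<close>

definition gen_binom :: "real \<Rightarrow> real \<Rightarrow> real" where
  "gen_binom p q = Gamma (p + 1) / (Gamma (q + 1) * Gamma (p - q + 1))"

definition nabla :: "(real \<Rightarrow> real) \<Rightarrow> real \<Rightarrow> real" where
  "nabla x k = x k - x (k - 1)"

text \<open>
  The operators below are meant for \<open>k \<in> Nats_from (a + 1)\<close>; there \<open>k - a - 1\<close> is a natural number,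
  so that taking the floor does not change it.
\<close>

definition GL_diff :: "real \<Rightarrow> real \<Rightarrow> (real \<Rightarrow> real) \<Rightarrow> real \<Rightarrow> real" where
  "GL_diff a \<beta> x k =
     (\<Sum>i = 0..nat \<lfloor>k - a - 1\<rfloor>. (-1) ^ i * gen_binom \<beta> (real i) * x (k - real i))"

definition caputo_diff :: "real \<Rightarrow> real \<Rightarrow> (real \<Rightarrow> real) \<Rightarrow> real \<Rightarrow> real" where
  "caputo_diff a \<alpha> x k = GL_diff a (\<alpha> - 1) (nabla x) k"

definition caputo_tempered_diff ::
    "real \<Rightarrow> real \<Rightarrow> (real \<Rightarrow> real) \<Rightarrow> (real \<Rightarrow> real) \<Rightarrow> real \<Rightarrow> real" where
  "caputo_tempered_diff a \<alpha> w x k = 1 / w k * caputo_diff a \<alpha> (\<lambda>j. w j * x j) k"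

end

theory Submission
  imports Defs
begin

text \<open>
  The comparison holds because the Caputo difference obeys a one-point maximum principle. Summation
  by parts turns \<^term>\<open>caputo_diff a \<alpha> z k\<close> into \<open>z k\<close> minus a combination of the earlier values
  \<open>z a, \<dots>, z (k - 1)\<close> with non-negative coefficients, since the weights
  \<open>(-1) ^ i * gen_binom (\<alpha> - 1) i\<close> start at \<open>1\<close>, are positive and decrease. Hence, if no
  earlier value is negative, the difference at \<open>k\<close> is at most \<open>z k\<close>
  (lemma \<open>caputo_diff_le_value\<close>). The tempered difference inherits this bound, because it does not
  change when \<open>w\<close> is divided by \<open>w a\<close>, and the normalised weight is positive
  (lemma \<open>caputo_tempered_diff_le_value\<close>).

  Let \<open>k\<close> be the first point with \<open>x k < y k\<close>. The principle, applied to \<open>x - y\<close>, makes the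
  tempered difference of \<open>x - y\<close> negative at \<open>k\<close>. But the two inequalities, in which \<open>h\<close> cancels,
  bound it below by \<open>\<gamma> (y k) - \<gamma> (x k)\<close>, which is positive as \<open>\<gamma>\<close> is strictly increasing.
\<close>

lemma gen_binom_0:
  assumes "p + 1 \<notin> \<int>\<^sub>\<le>\<^sub>0"
  shows "gen_binom p 0 = 1"
  using assms by (simp add: gen_binom_def Gamma_eq_zero_iff)

text \<open>
  For a non-integer \<open>p\<close> no Gamma factor that depends on \<open>p\<close> meets a pole, so the functional
  equation applies to each of them.
\<close>

lemma gen_binom_Suc:
  assumes "p \<notin> \<int>"
  shows "gen_binom p (real (Suc i)) = gen_binom p (real i) * (p - real i) / (real i + 1)"
proof -
  have nonint: "p - real i \<notin> \<int>"
    using assms by (metis Ints_add Ints_of_nat diff_add_cancel)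
  then have "p - real i \<notin> \<int>\<^sub>\<le>\<^sub>0"
    using nonpos_Ints_Int by blast
  then have lower: "Gamma (p - real i + 1) = (p - real i) * Gamma (p - real i)"
    by (rule Gamma_plus1)
  have upper: "Gamma (real (Suc i) + 1) = (real i + 1) * Gamma (real i + 1)"
    unfolding of_nat_Suc by (subst Gamma_plus1) (auto simp: add_ac dest: nonpos_Ints_nonpos)
  have shift: "p - real (Suc i) + 1 = p - real i"
    by simp
  have "p - real i \<noteq> 0"
    using nonint by auto
  then show ?thesis
    unfolding gen_binom_def shift lower upper by simp
qed

text \<open>
  For \<open>-1 < \<beta> < 0\<close> the binomials alternate in sign themselves, so these weights are all positive.
\<close>

definition GL_weight :: "real \<Rightarrow> nat \<Rightarrow> real" where
  "GL_weight \<beta> i = (-1) ^ i * gen_binom \<beta> (real i)"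

context
  fixes \<alpha> :: real
  assumes order: "0 < \<alpha>" "\<alpha> < 1"
begin

lemma GL_weight_0: "GL_weight (\<alpha> - 1) 0 = 1"
proof -
  have "\<alpha> - 1 + 1 \<notin> \<int>\<^sub>\<le>\<^sub>0"
    using order nonpos_Ints_nonpos[of \<alpha>] by auto
  from gen_binom_0[OF this] show ?thesis
    by (simp add: GL_weight_def)
qed

lemma GL_weight_Suc:
  "GL_weight (\<alpha> - 1) (Suc i) = GL_weight (\<alpha> - 1) i * ((real i + 1 - \<alpha>) / (real i + 1))"
proof -
  have nonint: "\<alpha> - 1 \<notin> \<int>"
    using order by (auto elim!: Ints_cases)
  show ?thesis
    unfolding GL_weight_def gen_binom_Suc[OF nonint] by (simp add: field_simps)
qed

lemma GL_weight_pos: "0 < GL_weight (\<alpha> - 1) i"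
  by (induction i) (use order in \<open>auto simp: GL_weight_0 GL_weight_Suc\<close>)

lemma GL_weight_Suc_le: "GL_weight (\<alpha> - 1) (Suc i) \<le> GL_weight (\<alpha> - 1) i"
  unfolding GL_weight_Suc
  by (rule mult_left_le) (use order GL_weight_pos[of i] in \<open>auto simp: field_simps\<close>)

end

lemma caputo_diff_eq_sum_GL_weight:
  "caputo_diff a \<alpha> z (a + real (Suc m)) =
     (\<Sum>i\<le>m. GL_weight (\<alpha> - 1) i * (z (a + real (Suc m - i)) - z (a + real (m - i))))"
proof -
  have "nat \<lfloor>a + real (Suc m) - a - 1\<rfloor> = m"
    by simp
  then show ?thesis
    unfolding caputo_diff_def GL_diff_def GL_weight_def nabla_def atLeast0AtMost
    by (auto intro!: sum.cong simp: of_nat_diff algebra_simps)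
qed

text \<open>
  After the index shift of summation by parts, each \<open>z (a + real (m - i))\<close> with \<open>i < m\<close> occurs once
  with weight number \<open>i + 1\<close> and once, negatively, with the larger weight number \<open>i\<close>, while the
  initial value \<open>z a\<close> occurs only negatively. So the earlier values cannot contribute a positive
  amount.
\<close>

lemma caputo_diff_le_value:
  assumes "0 < \<alpha>" "\<alpha> < 1"
    and nonneg: "\<And>j. j \<le> m \<Longrightarrow> 0 \<le> z (a + real j)"
  shows "caputo_diff a \<alpha> z (a + real (Suc m)) \<le> z (a + real (Suc m))"
proof -
  define c where "c = GL_weight (\<alpha> - 1)"
  have "(\<Sum>i\<le>m. c i * z (a + real (Suc m - i)))
      = z (a + real (Suc m)) + (\<Sum>i<m. c (Suc i) * z (a + real (m - i)))"
    using assms by (simp add: sum.atMost_shift c_def GL_weight_0)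
  also have "\<dots> \<le> z (a + real (Suc m)) + (\<Sum>i<m. c i * z (a + real (m - i)))"
    unfolding c_def
    by (intro add_left_mono sum_mono mult_right_mono GL_weight_Suc_le nonneg)
       (use assms in auto)
  also have "\<dots> \<le> z (a + real (Suc m)) + (\<Sum>i\<le>m. c i * z (a + real (m - i)))"
    unfolding c_def
    by (intro add_left_mono sum_mono2 mult_nonneg_nonneg less_imp_le[OF GL_weight_pos] nonneg)
       (use assms in auto)
  finally show ?thesis
    unfolding caputo_diff_eq_sum_GL_weight c_def
    by (simp add: right_diff_distrib sum_subtractf)
qed

lemma caputo_diff_cmult: "caputo_diff a \<alpha> (\<lambda>j. c * z j) k = c * caputo_diff a \<alpha> z k"
  by (simp add: caputo_diff_def GL_diff_def nabla_def sum_distrib_left algebra_simps)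

lemma caputo_diff_diff:
  "caputo_diff a \<alpha> (\<lambda>j. u j - v j) k = caputo_diff a \<alpha> u k - caputo_diff a \<alpha> v k"
  by (simp add: caputo_diff_def GL_diff_def nabla_def sum_subtractf algebra_simps
      flip: sum.distrib)

lemma caputo_tempered_diff_diff:
  "caputo_tempered_diff a \<alpha> w (\<lambda>j. x j - y j) k
     = caputo_tempered_diff a \<alpha> w x k - caputo_tempered_diff a \<alpha> w y k"
  by (simp add: caputo_tempered_diff_def right_diff_distrib caputo_diff_diff diff_divide_distrib)

text \<open>
  Normalising the weight at \<open>a\<close> reduces the claim to the untempered one, also when \<open>w\<close> is negative.
\<close>

lemma caputo_tempered_diff_le_value:
  assumes "0 < \<alpha>" "\<alpha> < 1"
    and w: "\<And>j. j \<le> Suc m \<Longrightarrow> 0 < w a / w (a + real j)"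
    and nonneg: "\<And>j. j \<le> m \<Longrightarrow> 0 \<le> z (a + real j)"
  shows "caputo_tempered_diff a \<alpha> w z (a + real (Suc m)) \<le> z (a + real (Suc m))"
proof -
  define k where "k = a + real (Suc m)"
  define v where "v = (\<lambda>j. 1 / w a * (w j * z j))"
  have pos: "0 < w a / w k"
    using w[of "Suc m"] by (simp add: k_def)
  have bound: "caputo_diff a \<alpha> v k \<le> v k"
    unfolding k_def
  proof (rule caputo_diff_le_value)
    fix j assume "j \<le> m"
    then have "0 < inverse (w a / w (a + real j))"
      using w[of j] by (simp only: positive_imp_inverse_positive)
    then show "0 \<le> v (a + real j)"
      using nonneg[OF \<open>j \<le> m\<close>] by (auto simp: v_def zero_less_divide_iff zero_le_divide_iff
          zero_le_mult_iff mult_le_0_iff)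
  qed fact+
  have "caputo_tempered_diff a \<alpha> w z k = w a / w k * caputo_diff a \<alpha> v k"
    unfolding v_def caputo_diff_cmult using pos by (auto simp: caputo_tempered_diff_def)
  also have "\<dots> \<le> w a / w k * v k"
    using pos bound by (intro mult_left_mono) auto
  also have "w a / w k * v k = z k"
    using pos by (auto simp: v_def)
  finally show ?thesis
    by (simp add: k_def)
qed

theorem theorem3p5:
  fixes a \<alpha> :: real and w \<gamma> h x y :: "real \<Rightarrow> real"
  assumes "0 < \<alpha>" and "\<alpha> < 1"
    and "\<And>k. k \<in> Nats_from a \<Longrightarrow> w k \<noteq> 0"
    and "\<And>k. k \<in> Nats_from (a + 1) \<Longrightarrow> w a / w k > 0"
    and "class_K \<gamma>" and "locally_lipschitz_on {0..} \<gamma>"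
    and "bounded (h ` Nats_from (a + 1))"
    and "\<And>k. k \<in> Nats_from a \<Longrightarrow> x k \<ge> 0"
    and "\<And>k. k \<in> Nats_from a \<Longrightarrow> y k \<ge> 0"
    and "x a = y a"
    and "\<And>k. k \<in> Nats_from (a + 1) \<Longrightarrow> caputo_tempered_diff a \<alpha> w x k \<ge> - \<gamma> (x k) + h k"
    and "\<And>k. k \<in> Nats_from (a + 1) \<Longrightarrow> caputo_tempered_diff a \<alpha> w y k \<le> - \<gamma> (y k) + h k"
  shows "\<forall>k \<in> Nats_from (a + 1). x k \<ge> y k"
proof -
  have "y (a + real n) \<le> x (a + real n)" for n
  proof (induction n rule: less_induct)
    case (less n)
    show ?case
    proof (cases n)
      case 0
      with \<open>x a = y a\<close> show ?thesis
        by simp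
    next
      case (Suc m)
      define k where "k = a + real (Suc m)"
      have k: "k \<in> Nats_from a" "k \<in> Nats_from (a + 1)"
        by (auto simp: k_def Nats_from_def intro: exI[of _ m] exI[of _ "Suc m"])
      have w: "0 < w a / w (a + real j)" for j
      proof (cases j)
        case 0
        have "a \<in> Nats_from a"
          by (auto simp: Nats_from_def)
        with assms(3) 0 show ?thesis
          by simp
      next
        case (Suc i)
        then have "a + real j \<in> Nats_from (a + 1)"
          by (auto simp: Nats_from_def intro: exI[of _ i])
        with assms(4) show ?thesis .
      qed
      show ?thesis
      proof (rule ccontr)
        assume "\<not> ?thesis"
        then have lt: "x k < y k"
          using Suc by (simp add: k_def)
        have "caputo_tempered_diff a \<alpha> w (\<lambda>j. x j - y j) k \<le> x k - y k"
          unfolding k_def using \<open>0 < \<alpha>\<close> \<open>\<alpha> < 1\<close> w less.IH Suc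
          by (intro caputo_tempered_diff_le_value) auto
        moreover have "\<gamma> (y k) - \<gamma> (x k) \<le> caputo_tempered_diff a \<alpha> w (\<lambda>j. x j - y j) k"
          using assms(11,12)[OF k(2)] by (simp add: caputo_tempered_diff_diff)
        moreover have "\<gamma> (x k) < \<gamma> (y k)"
          using \<open>class_K \<gamma>\<close> lt assms(8,9)[OF k(1)]
          by (auto simp: class_K_def strict_mono_on_def)
        ultimately show False
          using lt by simp
      qed
    qed
  qed
  moreover have "\<exists>n. k = a + real n" if "k \<in> Nats_from (a + 1)" for k
    using that by (auto simp: Nats_from_def intro: exI[of _ "Suc _"])
  ultimately show ?thesis
    by blast
qed

end
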